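(* Let $k$ be a nonzero integer. Then for every positive integer $n\ge 1$, the generalized Bernoulli numbers satisfy $$B_{n}^{(k+1)}=\left(1-\frac{n}{k}\right)B_{n}^{(k)}-nB_{n-1}^{(k)}.$$
   Context: For any integer $m$, the generalized Bernoulli numbers $B_n^{(m)}$ are defined by the formal power series identity $\left(1+\sum_{n\geq 1}\frac{1}{(n+1)!}X^{n}\right)^{-m}=1+\sum_{n\geq 1}\frac{1}{n!}B_{n}^{(m)}X^{n}$, with $B_0^{(m)}=1$. *)

theory Defs
  imports Complex_Main "HOL-Computational_Algebra.Formal_Power_Series"
begin

text \<open>The series \<open>1 + (\<Sum>n\<ge>1. X ^ n / (n + 1)!)\<close>, i.e. \<open>(exp X - 1) / X\<close>; the leading
  \<open>1\<close> is the coefficient \<open>1 / 1!\<close> at \<open>n = 0\<close>.\<close>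

definition gen_bernoulli_base :: "rat fps" where
  "gen_bernoulli_base = Abs_fps (\<lambda>n. 1 / fact (n + 1))"

text \<open>The constant coefficient of the base series is nonzero, so \<open>inverse\<close> on formal power
  series, and hence the integer power \<open>powi\<close>, is the genuine one in \<open>\<rat>[[X]]\<close>.\<close>

definition gen_bernoulli :: "int \<Rightarrow> nat \<Rightarrow> rat" where
  "gen_bernoulli m n = fact n * fps_nth (gen_bernoulli_base powi (- m)) n"

lemma gen_bernoulli_base_eq:
  "gen_bernoulli_base = 1 + Abs_fps (\<lambda>n. if n \<ge> 1 then 1 / fact (n + 1) else 0)"
proof (rule fps_ext)
  fix n
  show "fps_nth gen_bernoulli_base n
    = fps_nth (1 + Abs_fps (\<lambda>n. if n \<ge> 1 then 1 / fact (n + 1) else 0)) n"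
    by (cases n) (simp_all add: gen_bernoulli_base_def)
qed

lemma gen_bernoulli_base_inverse: "gen_bernoulli_base * inverse gen_bernoulli_base = 1"
  by (subst mult.commute, rule inverse_mult_eq_1) (simp add: gen_bernoulli_base_def)

lemma gen_bernoulli_0: "gen_bernoulli m 0 = 1"
  by (simp add: gen_bernoulli_def gen_bernoulli_base_def power_int_def fps_nth_power_0)

lemma gen_bernoulli_generating_series:
  "gen_bernoulli_base powi (- m)
     = 1 + Abs_fps (\<lambda>n. if n \<ge> 1 then 1 / fact n * gen_bernoulli m n else 0)"
proof (rule fps_ext)
  fix n
  show "fps_nth (gen_bernoulli_base powi (- m)) n
    = fps_nth (1 + Abs_fps (\<lambda>n. if n \<ge> 1 then 1 / fact n * gen_bernoulli m n else 0)) n"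
    using gen_bernoulli_0[of m] by (cases n) (simp_all add: gen_bernoulli_def)
qed

end

theory Submission
  imports Defs
begin

text \<open>Write \<open>F = (exp X - 1) / X\<close> for the base series. Differentiating \<open>X F = exp X - 1\<close>
  gives \<open>F + X F' = exp X = 1 + X F\<close>, so \<open>F\<close> satisfies the first-order equation
  \<open>X F' = 1 + X F - F\<close> (lemma \<open>X_mult_deriv_gen_bernoulli_base\<close>). By the power rule,
  \<open>X (F\<^sup>-\<^sup>k)' = - k F\<^sup>-\<^sup>k\<^sup>-\<^sup>1 X F'\<close>, and the equation turns the right-hand side into
  \<open>k F\<^sup>-\<^sup>k - k X F\<^sup>-\<^sup>k - k F\<^sup>-\<^sup>k\<^sup>-\<^sup>1\<close>. Only the generating series of orders \<open>k\<close> and \<open>k + 1\<close>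
  occur here, and comparing the coefficients of \<open>X\<^sup>n\<close> is the recurrence.\<close>

lemma fps_power_int_minus_nat: "f powi (- int j) = inverse f ^ j" for f :: "'a::field fps"
  by (cases j) (simp_all add: power_int_def nat_add_distrib)

text \<open>Formal power series over a field are not a division ring, so the usual laws of integer
  powers have to be derived for series that are units, that is, series with nonzero constant
  coefficient.\<close>

lemma fps_mult_power_int_diff_1:
  fixes f :: "'a::field fps"
  assumes "fps_nth f 0 \<noteq> 0"
  shows "f * f powi (m - 1) = f powi m"
proof (cases m rule: int_cases)
  case (nonneg j)
  then show ?thesis
    using inverse_mult_eq_1'[OF assms] by (cases j) (simp_all add: power_int_def nat_add_distrib)
next
  case (neg j)
  have eq: "m - 1 = - int (Suc (Suc j))"
    using neg by simp
  have "f * f powi (m - 1) = (f * inverse f) * inverse f ^ Suc j"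
    unfolding eq fps_power_int_minus_nat by (simp add: mult.assoc)
  also have "\<dots> = f powi m"
    unfolding neg fps_power_int_minus_nat inverse_mult_eq_1'[OF assms] by simp
  finally show ?thesis .
qed

lemma fps_deriv_power_int:
  fixes f :: "'a::field fps"
  assumes "fps_nth f 0 \<noteq> 0"
  shows "fps_deriv (f powi m) = of_int m * f powi (m - 1) * fps_deriv f"
proof (cases m rule: int_cases)
  case (nonneg j)
  then show ?thesis
    by (cases j)
      (simp_all add: power_int_def nat_add_distrib fps_deriv_power' mult_ac del: power_Suc)
next
  case (neg j)
  have eq: "m - 1 = - int (Suc (Suc j))"
    using neg by simp
  have "fps_deriv (f powi m) = of_nat (Suc j) * fps_deriv (inverse f) * inverse f ^ j"
    unfolding neg fps_power_int_minus_nat fps_deriv_power' by simp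
  also have "\<dots> = - of_nat (Suc j) * inverse f ^ Suc (Suc j) * fps_deriv f"
    using fps_inverse_deriv[OF assms] by (simp add: power2_eq_square algebra_simps)
  also have "\<dots> = of_int m * f powi (m - 1) * fps_deriv f"
    unfolding eq fps_power_int_minus_nat unfolding neg by simp
  finally show ?thesis .
qed

lemma X_mult_gen_bernoulli_base: "fps_X * gen_bernoulli_base = fps_exp 1 - 1"
proof (rule fps_ext)
  fix n
  show "fps_nth (fps_X * gen_bernoulli_base) n = fps_nth (fps_exp 1 - 1) n"
    by (cases n) (simp_all add: gen_bernoulli_base_def algebra_simps)
qed

lemma X_mult_deriv_gen_bernoulli_base:
  "fps_X * fps_deriv gen_bernoulli_base = 1 + fps_X * gen_bernoulli_base - gen_bernoulli_base"
proof -
  have "gen_bernoulli_base + fps_X * fps_deriv gen_bernoulli_base = fps_exp 1"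
    using arg_cong[OF X_mult_gen_bernoulli_base, of fps_deriv] by (simp add: add.commute)
  then show ?thesis
    using X_mult_gen_bernoulli_base by (simp add: algebra_simps)
qed

lemma X_mult_deriv_gen_bernoulli_series:
  "fps_X * fps_deriv (gen_bernoulli_base powi (- k)) =
    of_int k * (gen_bernoulli_base powi (- k) - fps_X * gen_bernoulli_base powi (- k)
      - gen_bernoulli_base powi (- (k + 1)))"
proof -
  let ?F = gen_bernoulli_base
  let ?G = "?F powi (- k)" and ?H = "?F powi (- (k + 1))"
  have unit: "fps_nth ?F 0 \<noteq> 0"
    by (simp add: gen_bernoulli_base_def)
  have lower: "?F * ?H = ?G"
    using fps_mult_power_int_diff_1[OF unit, of "- k"] by simp
  have "fps_X * fps_deriv ?G = - of_int k * ?H * (fps_X * fps_deriv ?F)"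
    using fps_deriv_power_int[OF unit, of "- k"] by (simp add: mult_ac)
  also have "\<dots> = of_int k * (?F * ?H - fps_X * (?F * ?H) - ?H)"
    by (simp add: X_mult_deriv_gen_bernoulli_base algebra_simps)
  finally show ?thesis
    by (simp only: lower)
qed

theorem theorem2p13:
  fixes k :: int and n :: nat
  assumes "k \<noteq> 0" and "n \<ge> 1"
  shows "gen_bernoulli (k + 1) n
    = (1 - of_nat n / of_int k) * gen_bernoulli k n - of_nat n * gen_bernoulli k (n - 1)"
proof -
  let ?g = "fps_nth (gen_bernoulli_base powi (- k))"
  let ?h = "fps_nth (gen_bernoulli_base powi (- (k + 1)))"
  have "of_nat n * ?g n = of_int k * (?g n - ?g (n - 1) - ?h n)"
    using arg_cong[OF X_mult_deriv_gen_bernoulli_series[of k], of "\<lambda>f. fps_nth f n"] assms(2)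
    by (simp add: fps_of_int[symmetric])
  then have h: "?h n = (1 - of_nat n / of_int k) * ?g n - ?g (n - 1)"
    using assms(1) by (simp add: field_simps)
  have fact_n: "(fact n :: rat) = of_nat n * fact (n - 1)"
    using assms(2) by (simp add: fact_reduce)
  have "gen_bernoulli (k + 1) n = (1 - of_nat n / of_int k) * (fact n * ?g n) - fact n * ?g (n - 1)"
    unfolding gen_bernoulli_def h by (simp add: algebra_simps)
  also have "fact n * ?g (n - 1) = of_nat n * (fact (n - 1) * ?g (n - 1))"
    by (simp add: fact_n)
  finally show ?thesis
    unfolding gen_bernoulli_def .
qed

end
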